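(* Let $F$ be a field and let $\lambda$ be a partition. Let $P_\lambda\in\mathbb{Z}[e_1,e_2,\dots]$ be the unique polynomial with integer coefficients such that the Schur function $s_\lambda$ equals $P_\lambda$ evaluated at the elementary symmetric functions $e_1,e_2,\dots$, and regard $P_\lambda$ as a polynomial over $F$ via the canonical ring map $\mathbb{Z}\to F$, treating the $e_i$ as indeterminates. Then there exist values for the variables $e_i$, all taken in the set $\{0,1\}\subseteq F$, at which $P_\lambda$ takes a non-zero value in $F$.
   Context: $s_\lambda$ is the Schur symmetric function associated to $\lambda$, and $e_i$ is the $i$-th elementary symmetric function (with $e_0=1$ and $e_i=0$ for $i<0$). By the Jacobi–Trudi (dual) identity, $s_\lambda=\det(e_{\lambda'_i-i+j})_{1\le i,j\le n}$ where $\lambda'$ is the conjugate partition and $n$ is the length of $\lambda'$; since the $e_i$ are algebraically independent, this expresses $s_\lambda$ as a uniquely determined polynomial in the $e_i$ with integer coefficients. *)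

theory Defs
  imports Complex_Main "HOL-Library.Poly_Mapping" "HOL-Library.FuncSet"
begin

text \<open>
  Polynomials in the countably many indeterminates \<open>X\<^sub>0, X\<^sub>1, \<dots>\<close>: finitely supported coefficient
  functions on exponent vectors, with the convolution product of \<^theory>\<open>HOL-Library.Poly_Mapping\<close>.
\<close>

type_synonym 'a mpoly = "(nat \<Rightarrow>\<^sub>0 nat) \<Rightarrow>\<^sub>0 'a"

definition mvar :: "nat \<Rightarrow> 'a::comm_ring_1 mpoly" where
  "mvar i = Poly_Mapping.single (Poly_Mapping.single i 1) 1"

definition mpoly_eval :: "'a::comm_ring_1 mpoly \<Rightarrow> (nat \<Rightarrow> 'a) \<Rightarrow> 'a" where
  "mpoly_eval P a =
    (\<Sum>m\<in>Poly_Mapping.keys P. Poly_Mapping.lookup P m *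
       (\<Prod>i\<in>Poly_Mapping.keys m. a i ^ Poly_Mapping.lookup m i))"

definition mpoly_of_int :: "int mpoly \<Rightarrow> 'a::comm_ring_1 mpoly" where
  "mpoly_of_int P = Poly_Mapping.map of_int P"

text \<open>
  The ring of symmetric functions is the (graded) inverse limit of the rings of symmetric
  polynomials in \<open>N\<close> variables. A symmetric function \<open>f\<close> is accordingly given by its restrictions
  \<open>f N\<close> to the variables \<open>X\<^sub>0, \<dots>, X\<^sub>N\<^sub>-\<^sub>1\<close> (all other variables set to zero), for every \<open>N\<close>; the
  ring operations and equality are componentwise.
\<close>

type_synonym symfun = "nat \<Rightarrow> int mpoly"

definition elem_sym :: "nat \<Rightarrow> symfun" where
  "elem_sym k N = (\<Sum>S | S \<subseteq> {..<N} \<and> card S = k. \<Prod>i\<in>S. mvar i)"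

definition is_partition :: "nat list \<Rightarrow> bool" where
  "is_partition lam \<longleftrightarrow> sorted_wrt (\<ge>) lam \<and> 0 \<notin> set lam"

definition young_diagram :: "nat list \<Rightarrow> (nat \<times> nat) set" where
  "young_diagram lam = {(r, c). r < length lam \<and> c < lam ! r}"

definition ssyt :: "nat list \<Rightarrow> nat \<Rightarrow> (nat \<times> nat \<Rightarrow> nat) set" where
  "ssyt lam N =
    {T \<in> young_diagram lam \<rightarrow>\<^sub>E {..<N}.
       (\<forall>r c c'. c < c' \<and> (r, c') \<in> young_diagram lam \<longrightarrow> T (r, c) \<le> T (r, c')) \<and>
       (\<forall>r r' c. r < r' \<and> (r', c) \<in> young_diagram lam \<longrightarrow> T (r, c) < T (r', c))}"

definition schur :: "nat list \<Rightarrow> symfun" where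
  "schur lam N = (\<Sum>T\<in>ssyt lam N. \<Prod>b\<in>young_diagram lam. mvar (T b))"

text \<open>
  Substitution of the elementary symmetric functions into an integer polynomial. The
  indeterminates are numbered from \<open>0\<close>, so \<open>X\<^sub>i\<close> plays the role of \<open>e\<^sub>i\<^sub>+\<^sub>1\<close>.
\<close>

definition eval_at_elem_sym :: "int mpoly \<Rightarrow> symfun" where
  "eval_at_elem_sym P N = mpoly_eval (mpoly_of_int P) (\<lambda>i. elem_sym (Suc i) N)"

definition schur_elem_poly :: "nat list \<Rightarrow> int mpoly" where
  "schur_elem_poly lam = (THE P. schur lam = eval_at_elem_sym P)"

end

theory Submission
  imports Defs "Jordan_Normal_Form.Determinant"
    "HOL-Computational_Algebra.Fundamental_Theorem_Algebra"
begin

text \<open>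
  By the dual Jacobi-Trudi identity \<open>P\<close> is \<open>det (e\<^bsub>\<lambda>'\<^sub>i-i+j\<^esub>)\<close>. The variable of largest index sits only
  in the top right corner of this matrix, and the complementary minor is (after deleting trivial
  rows) again a Jacobi-Trudi matrix, namely that of \<open>\<lambda>\<close> with its first hook removed. By induction the
  minor is nonzero at some 0-1 point, so the determinant is affine in the corner variable with
  nonzero slope, and one of the two values of that variable works.
\<close>

section \<open>Evaluation of integer polynomials\<close>

text \<open>\<open>schur_elem_poly\<close> is a definite description, so the determinant can replace
  it only once two facts are known: it represents the tableau sum \<open>schur\<close> in every
  number of variables, and no other integer polynomial does. The second fact is algebraic
  independence. One integer polynomial is thus evaluated at symmetric polynomials, at complex
  numbers and at 0-1 points of F, all through \<open>int_eval\<close>. The minor enters with factor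
  plus or minus 1, which is why the argument works in every characteristic.\<close>

definition monom_val :: "(nat \<Rightarrow>\<^sub>0 nat) \<Rightarrow> (nat \<Rightarrow> 'a::comm_ring_1) \<Rightarrow> 'a" where
  "monom_val m a = (\<Prod>i\<in>Poly_Mapping.keys m. a i ^ Poly_Mapping.lookup m i)"

text \<open>The sum runs over the support of the integer polynomial; the support of its image in the
  target ring may be smaller in positive characteristic.\<close>

definition int_eval :: "int mpoly \<Rightarrow> (nat \<Rightarrow> 'a::comm_ring_1) \<Rightarrow> 'a" where
  "int_eval P a = (\<Sum>m\<in>Poly_Mapping.keys P. of_int (Poly_Mapping.lookup P m) * monom_val m a)"

lemma monom_val_superset:
  assumes "finite A" "Poly_Mapping.keys m \<subseteq> A"
  shows "monom_val m a = (\<Prod>i\<in>A. a i ^ Poly_Mapping.lookup m i)"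
  unfolding monom_val_def
  by (rule prod.mono_neutral_left) (use assms in \<open>auto simp: in_keys_iff\<close>)

lemma monom_val_add: "monom_val (m + m') a = monom_val m a * monom_val m' a"
proof -
  let ?A = "Poly_Mapping.keys m \<union> Poly_Mapping.keys m'"
  have "monom_val (m + m') a = (\<Prod>i\<in>?A. a i ^ Poly_Mapping.lookup (m + m') i)"
    by (rule monom_val_superset) (simp_all add: keys_add)
  also have "\<dots> = (\<Prod>i\<in>?A. a i ^ Poly_Mapping.lookup m i) * (\<Prod>i\<in>?A. a i ^ Poly_Mapping.lookup m' i)"
    by (simp add: lookup_add power_add prod.distrib)
  also have "\<dots> = monom_val m a * monom_val m' a"
    by (simp add: monom_val_superset[of ?A])
  finally show ?thesis .
qed

lemma mpoly_eval_of_int: "mpoly_eval (mpoly_of_int P) a = int_eval P a"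
proof -
  have lk: "Poly_Mapping.lookup (mpoly_of_int P) m = of_int (Poly_Mapping.lookup P m)" for m
    by (simp add: mpoly_of_int_def Poly_Mapping.map.rep_eq when_def)
  show ?thesis
    unfolding mpoly_eval_def int_eval_def monom_val_def lk
    by (rule sum.mono_neutral_left) (auto simp: in_keys_iff lk)
qed

lemma int_eval_0 [simp]: "int_eval 0 a = 0"
  by (simp add: int_eval_def)

lemma int_eval_add: "int_eval (P + Q) a = int_eval P a + int_eval Q a"
  unfolding int_eval_def
  by (rule setsum_keys_plus_distrib[where f = "\<lambda>m c. of_int c * monom_val m a"])
     (simp_all add: algebra_simps)

lemma int_eval_diff: "int_eval (P - Q) a = int_eval P a - int_eval Q a"
  using int_eval_add[of "P - Q" Q a] by (simp add: algebra_simps)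

lemma int_eval_single: "int_eval (Poly_Mapping.single m c) a = of_int c * monom_val m a"
  by (simp add: int_eval_def)

lemma poly_mapping_add_single_induct [case_names zero add]:
  fixes P :: "('a \<Rightarrow>\<^sub>0 'b::monoid_add) \<Rightarrow> bool"
  assumes "P 0" and step: "\<And>f k b. P f \<Longrightarrow> P (f + Poly_Mapping.single k b)"
  shows "P f"
proof (induction f rule: Poly_Mapping.update_induct)
  case const
  show ?case by fact
next
  case (update f a b)
  have "Poly_Mapping.update a b f = f + Poly_Mapping.single a b"
    using update.hyps
    by (intro poly_mapping_eqI)
       (auto simp: lookup_update lookup_add lookup_single when_def in_keys_iff)
  then show ?case using step[OF update.IH] by simp
qed

lemma int_eval_mult: "int_eval (P * Q) a = int_eval P a * int_eval Q a"
proof (induction P rule: poly_mapping_add_single_induct)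
  case (add P k b)
  have "int_eval (Poly_Mapping.single k b * Q) a = int_eval (Poly_Mapping.single k b) a * int_eval Q a"
    by (induction Q rule: poly_mapping_add_single_induct)
       (simp_all add: int_eval_add int_eval_single Poly_Mapping.mult_single monom_val_add algebra_simps)
  with add show ?case by (simp add: int_eval_add algebra_simps)
qed simp

lemma int_eval_1 [simp]: "int_eval 1 a = 1"
  by (simp add: int_eval_def monom_val_def)

lemma int_eval_mvar [simp]: "int_eval (mvar i) a = a i"
  by (simp add: mvar_def int_eval_single monom_val_def)

lemma comm_ring_hom_int_eval: "comm_ring_hom (\<lambda>P. int_eval P a)"
  by unfold_locales (simp_all add: int_eval_add int_eval_mult)

text \<open>Integer coefficients are fixed by every ring homomorphism. This lets a polynomial
  obtained by substitution be evaluated further at a point.\<close>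

lemma int_eval_hom:
  assumes "comm_ring_hom h"
  shows "h (int_eval P a) = int_eval P (\<lambda>i. h (a i))"
proof -
  interpret comm_ring_hom h by fact
  show ?thesis
    by (simp add: int_eval_def monom_val_def hom_distribs)
qed

section \<open>Algebraic independence of the elementary symmetric functions\<close>

definition esym :: "(nat \<Rightarrow> 'a::comm_ring_1) \<Rightarrow> nat \<Rightarrow> nat \<Rightarrow> 'a" where
  "esym x k N = (\<Sum>S | S \<subseteq> {..<N} \<and> card S = k. \<Prod>i\<in>S. x i)"

lemma elem_sym_eq_esym: "elem_sym k N = esym mvar k N"
  by (simp add: elem_sym_def esym_def)

lemma int_eval_esym: "int_eval (esym y k N) x = esym (\<lambda>i. int_eval (y i) x) k N"
proof -
  interpret comm_ring_hom "\<lambda>P. int_eval P x" by (rule comm_ring_hom_int_eval)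
  show ?thesis by (simp add: esym_def hom_distribs)
qed

section \<open>Vieta's formula and prescribed values over the complex numbers\<close>

lemma prod_linear_expansion:
  "(\<Prod>i<N. [:x i, 1:]) = (\<Sum>X\<in>Pow {..<N}. monom (\<Prod>i\<in>X. x i) (N - card X))"
proof -
  have "(\<Prod>i<N. [:x i, 1:]) = (\<Prod>i<N. [:x i:] + monom 1 1)"
    by (simp add: monom_altdef)
  also have "\<dots> = (\<Sum>X\<in>Pow {..<N}. (\<Prod>i\<in>X. [:x i:]) * (\<Prod>i\<in>{..<N} - X. monom 1 1))"
    by (rule prod_add) simp
  also have "\<dots> = (\<Sum>X\<in>Pow {..<N}. monom (\<Prod>i\<in>X. x i) (N - card X))"
  proof (rule sum.cong)
    fix X assume X: "X \<in> Pow {..<N}"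
    have "(\<Prod>i\<in>X. [:x i:]) = [:\<Prod>i\<in>X. x i:]"
      by (induction X rule: infinite_finite_induct) (auto simp: mult_ac)
    moreover have "(\<Prod>i\<in>{..<N} - X. monom 1 1) = monom (1::'a) (N - card X)"
      using X by (simp add: card_Diff_subset finite_subset[of X "{..<N}"] monom_power)
    ultimately show "(\<Prod>i\<in>X. [:x i:]) * (\<Prod>i\<in>{..<N} - X. monom 1 1) = monom (\<Prod>i\<in>X. x i) (N - card X)"
      by (simp add: smult_monom)
  qed simp
  finally show ?thesis .
qed

text \<open>Vieta's formula; no signs occur because the factors are X + x_i.\<close>

lemma coeff_prod_linear:
  assumes "k \<le> N"
  shows "coeff (\<Prod>i<N. [:x i, 1:]) (N - k) = esym x k N"
proof -
  have *: "N - card X = N - k \<longleftrightarrow> card X = k" if "X \<in> Pow {..<N}" for X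
    using card_mono[of "{..<N}" X] that assms by auto
  have "coeff (\<Prod>i<N. [:x i, 1:]) (N - k) = (\<Sum>X\<in>Pow {..<N}. if card X = k then \<Prod>i\<in>X. x i else 0)"
    by (auto simp: prod_linear_expansion coeff_sum * intro!: sum.cong)
  also have "\<dots> = (\<Sum>X\<in>{X \<in> Pow {..<N}. card X = k}. \<Prod>i\<in>X. x i)"
    by (rule sum.inter_filter[symmetric]) simp
  also have "{X \<in> Pow {..<N}. card X = k} = {S. S \<subseteq> {..<N} \<and> card S = k}" by auto
  finally show ?thesis by (simp add: esym_def)
qed

text \<open>Complex polynomials split, so the x_i can be taken as the negated roots of the monic
  polynomial with coefficients c_k.\<close>

lemma esym_complex_surj:
  fixes c :: "nat \<Rightarrow> complex"
  obtains x where "\<And>k. 1 \<le> k \<Longrightarrow> k \<le> N \<Longrightarrow> esym x k N = c k"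
proof -
  \<comment> \<open>The value at 0 is forced to be e_0 = 1, which makes \<open>p\<close>
    monic.\<close>
  define c' where "c' = c(0 := 1)"
  define p where "p = (\<Sum>k\<le>N. monom (c' k) (N - k))"
  have co: "coeff p (N - k) = c' k" if "k \<le> N" for k
  proof -
    have "coeff p (N - k) = (\<Sum>j\<le>N. if j = k then c' j else 0)"
      unfolding p_def coeff_sum using that by (intro sum.cong) auto
    then show ?thesis using that by simp
  qed
  have "degree p \<le> N"
    unfolding p_def by (intro degree_sum_le) (auto intro: order.trans[OF degree_monom_le])
  moreover have c1: "coeff p N = 1" using co[of 0] by (simp add: c'_def)
  ultimately have deg: "degree p = N"
    by (metis le_antisym le_degree zero_neq_one)
  obtain root where "smult (lead_coeff p) (\<Prod>i<degree p. [:-root i, 1:]) = p"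
    by (rule complex_poly_decompose')
  then have p: "p = (\<Prod>i<N. [:- root i, 1:])" using deg c1 by simp
  show ?thesis
  proof (rule that)
    fix k assume "1 \<le> k" "k \<le> N"
    then show "esym (\<lambda>i. - root i) k N = c k"
      using coeff_prod_linear[of k N "\<lambda>i. - root i"] co[of k] by (simp add: p[symmetric] c'_def)
  qed
qed

text \<open>The least digit is the residue modulo B, and the quotient has one digit less.\<close>

lemma base_expansion_unique:
  fixes f g :: "nat \<Rightarrow> nat"
  assumes "\<And>i. i < N \<Longrightarrow> f i < B" "\<And>i. i < N \<Longrightarrow> g i < B"
    and "(\<Sum>i<N. f i * B ^ i) = (\<Sum>i<N. g i * B ^ i)" and "i < N"
  shows "f i = g i"
  using assms
proof (induction N arbitrary: f g i)
  case (Suc N)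
  have sh: "(\<Sum>i<Suc N. f i * B ^ i) = f 0 + B * (\<Sum>i<N. f (Suc i) * B ^ i)" for f :: "nat \<Rightarrow> nat"
    by (simp add: sum.lessThan_Suc_shift sum_distrib_left mult_ac del: sum.lessThan_Suc)
  have lt: "f 0 < B" "g 0 < B" using Suc.prems by auto
  have eq: "f 0 + B * (\<Sum>i<N. f (Suc i) * B ^ i) = g 0 + B * (\<Sum>i<N. g (Suc i) * B ^ i)"
    using Suc.prems(3) by (simp only: sh)
  have 0: "f 0 = g 0"
    using arg_cong[OF eq, of "\<lambda>x. x mod B"] lt by simp
  with eq lt have "(\<Sum>i<N. f (Suc i) * B ^ i) = (\<Sum>i<N. g (Suc i) * B ^ i)" by simp
  then have "f (Suc j) = g (Suc j)" if "j < N" for j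
    using Suc.IH[of "\<lambda>i. f (Suc i)" "\<lambda>i. g (Suc i)" j] Suc.prems that by simp
  with 0 Suc.prems(4) show ?case by (cases i) auto
qed simp

text \<open>Over the complex numbers the elementary symmetric polynomials take arbitrary values, so
  one may substitute powers \<open>t ^ B ^ i\<close> with \<open>B\<close> larger than all exponents; distinct monomials
  then become distinct powers of \<open>t\<close>.\<close>

lemma elem_sym_algebraically_independent:
  assumes "\<And>N. int_eval P (\<lambda>i. elem_sym (Suc i) N) = 0"
  shows "P = 0"
proof (rule ccontr)
  assume "P \<noteq> 0"
  then obtain m0 where m0: "m0 \<in> Poly_Mapping.keys P" by (metis all_not_in_conv keys_eq_empty)
  define V where "V = (\<Union>m\<in>Poly_Mapping.keys P. Poly_Mapping.keys m)"
  have "finite V" by (simp add: V_def)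
  then obtain N where N: "\<And>i. i \<in> V \<Longrightarrow> i < N"
    using finite_nat_set_iff_bounded by auto
  have "finite (\<Union>m\<in>Poly_Mapping.keys P. Poly_Mapping.lookup m ` {..<N})" by simp
  then obtain B where B: "\<And>m i. m \<in> Poly_Mapping.keys P \<Longrightarrow> i < N \<Longrightarrow> Poly_Mapping.lookup m i < B"
    using finite_nat_set_iff_bounded by (metis (no_types, lifting) UN_I imageI lessThan_iff)
  have sub: "Poly_Mapping.keys m \<subseteq> {..<N}" if "m \<in> Poly_Mapping.keys P" for m
    using that N by (auto simp: V_def)
  \<comment> \<open>\<open>w m\<close> is the exponent of t that the monomial m acquires when X_i is
    replaced by \<open>t ^ (B ^ i)\<close>.\<close>
  define w where "w m = (\<Sum>i<N. Poly_Mapping.lookup m i * B ^ i)" for m :: "nat \<Rightarrow>\<^sub>0 nat"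
  have w_inj: "m = m'" if "m \<in> Poly_Mapping.keys P" "m' \<in> Poly_Mapping.keys P" "w m = w m'" for m m'
  proof (rule poly_mapping_eqI)
    fix i
    show "Poly_Mapping.lookup m i = Poly_Mapping.lookup m' i"
    proof (cases "i < N")
      case True
      then show ?thesis
        using base_expansion_unique[of N "Poly_Mapping.lookup m" B "Poly_Mapping.lookup m'" i]
          that B by (simp add: w_def)
    next
      case False
      then show ?thesis using sub that by (metis in_keys_iff lessThan_iff subsetD)
    qed
  qed
  define p :: "complex poly"
    where "p = (\<Sum>m\<in>Poly_Mapping.keys P. monom (of_int (Poly_Mapping.lookup P m)) (w m))"
  have "poly p t = 0" for t
  proof -
    \<comment> \<open>The exponent involves k - 1 because X_i stands for e_(i+1).\<close>
    obtain x where x: "\<And>k. 1 \<le> k \<Longrightarrow> k \<le> N \<Longrightarrow> esym x k N = t ^ (B ^ (k - 1))"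
      using esym_complex_surj[of N "\<lambda>k. t ^ (B ^ (k - 1))"] by blast
    have mv: "monom_val m (\<lambda>i. esym x (Suc i) N) = t ^ w m" if "m \<in> Poly_Mapping.keys P" for m
    proof -
      have "monom_val m (\<lambda>i. esym x (Suc i) N) = (\<Prod>i<N. esym x (Suc i) N ^ Poly_Mapping.lookup m i)"
        using sub[OF that] by (intro monom_val_superset) auto
      also have "\<dots> = (\<Prod>i<N. t ^ (Poly_Mapping.lookup m i * B ^ i))"
        using x by (intro prod.cong) (auto simp: power_mult[symmetric] mult.commute)
      finally show ?thesis by (simp add: w_def power_sum)
    qed
    have "0 = int_eval (int_eval P (\<lambda>i. elem_sym (Suc i) N)) x"
      using assms by simp
    also have "\<dots> = int_eval P (\<lambda>i. esym x (Suc i) N)"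
      by (simp add: int_eval_hom[OF comm_ring_hom_int_eval] elem_sym_eq_esym int_eval_esym)
    also have "\<dots> = poly p t"
      by (simp add: int_eval_def p_def poly_sum poly_monom mv)
    finally show ?thesis by simp
  qed
  then have "p = 0" by (simp add: poly_all_0_iff_0[symmetric])
  then have "0 = coeff p (w m0)" by simp
  also have "\<dots> = (\<Sum>m\<in>Poly_Mapping.keys P. if m = m0 then of_int (Poly_Mapping.lookup P m) else 0)"
    unfolding p_def coeff_sum using w_inj m0 by (intro sum.cong) auto
  also have "\<dots> = of_int (Poly_Mapping.lookup P m0)" using m0 by simp
  finally show False using m0 by (simp add: in_keys_iff)
qed

text \<open>This is the uniqueness that the definite description in \<open>schur_elem_poly\<close>
  requires.\<close>

lemma eval_at_elem_sym_inj:
  assumes "eval_at_elem_sym P = eval_at_elem_sym Q"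
  shows "P = Q"
proof -
  have "int_eval (P - Q) (\<lambda>i. elem_sym (Suc i) N) = 0" for N
    using fun_cong[OF assms, of N]
    by (simp add: eval_at_elem_sym_def mpoly_eval_of_int int_eval_diff)
  then have "P - Q = 0" by (rule elem_sym_algebraically_independent)
  then show ?thesis by simp
qed

section \<open>Jacobi-Trudi determinants\<close>

text \<open>The index of \<open>E\<close> is an integer because h_i - i + j can be negative.
  \<open>E\<close> stays arbitrary so that the same lemmas serve indeterminates, their values and
  the delta sequence that arises for zero variables.\<close>

definition jt_det :: "nat \<Rightarrow> (nat \<Rightarrow> int) \<Rightarrow> (int \<Rightarrow> 'a::comm_ring_1) \<Rightarrow> 'a" where
  "jt_det n h E = det (mat n n (\<lambda>(i, j). E (h i + int j - int i)))"

text \<open>Partitions are given by their column lengths \<open>h = \<lambda>'\<close> with trailing zeros allowed; they are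
  integer-valued because lowering a column of length zero must not be truncated.\<close>

definition is_part :: "nat \<Rightarrow> (nat \<Rightarrow> int) \<Rightarrow> bool" where
  "is_part n h \<longleftrightarrow> (\<forall>i. Suc i < n \<longrightarrow> h (Suc i) \<le> h i) \<and> (\<forall>i<n. 0 \<le> h i)"

text \<open>On diagrams this removes the bottom cell of each column in X; if the result is again a
  partition, the removed cells form a horizontal strip.\<close>

definition lower :: "nat set \<Rightarrow> (nat \<Rightarrow> int) \<Rightarrow> nat \<Rightarrow> int" where
  "lower X h = (\<lambda>i. h i - of_bool (i \<in> X))"

lemma decreasing_below:
  fixes h :: "nat \<Rightarrow> int"
  assumes "\<And>i. Suc i < n \<Longrightarrow> h (Suc i) \<le> h i" "i \<le> j" "j < n"
  shows "h j \<le> h i"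
  using assms(2,3)
proof (induction j rule: dec_induct)
  case (step j)
  then show ?case using assms(1) by (meson Suc_lessD order.trans)
qed simp

lemma is_part_antimono: "is_part n h \<Longrightarrow> i \<le> j \<Longrightarrow> j < n \<Longrightarrow> h j \<le> h i"
  by (rule decreasing_below[of n]) (simp_all add: is_part_def)

lemma is_part_nonneg: "is_part n h \<Longrightarrow> i < n \<Longrightarrow> 0 \<le> h i"
  by (simp add: is_part_def)

lemma jt_det_cong:
  assumes "\<And>i j. i < n \<Longrightarrow> j < n \<Longrightarrow> E (h i + int j - int i) = F (g i + int j - int i)"
  shows "jt_det n h E = jt_det n g F"
  unfolding jt_det_def by (rule arg_cong[where f = det]) (use assms in auto)

lemma permutes_lt: "p permutes {0..<n} \<Longrightarrow> i < n \<Longrightarrow> p i < n" for n :: nat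
  by (metis atLeastLessThan_iff permutes_in_image zero_le)

text \<open>Multilinearity in the rows: row i for \<open>E\<close> is row i for \<open>F\<close>
  plus y times row i for \<open>F\<close> with h_i lowered by one. Taking the second summand exactly
  in the rows of X gives the term of X.\<close>

lemma jt_det_row_expansion:
  assumes "\<And>k. E k = F k + y * F (k - 1)"
  shows "jt_det n h E = (\<Sum>X\<in>Pow {..<n}. y ^ card X * jt_det n (lower X h) F)"
proof -
  let ?P = "{p. p permutes {0..<n}}"
  have "jt_det n h E = (\<Sum>p\<in>?P. signof p * (\<Prod>i=0..<n. E (h i + int (p i) - int i)))"
    unfolding jt_det_def by (subst det_def') (auto intro!: sum.cong prod.cong simp: permutes_lt)
  also have "\<dots> = (\<Sum>p\<in>?P. \<Sum>X\<in>Pow {..<n}. y ^ card X *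
      (signof p * (\<Prod>i=0..<n. F (lower X h i + int (p i) - int i))))"
  proof (rule sum.cong[OF refl])
    fix p
    have "(\<Prod>i=0..<n. E (h i + int (p i) - int i)) =
        (\<Prod>i<n. y * F (h i - 1 + int (p i) - int i) + F (h i + int (p i) - int i))"
      by (auto simp: assms atLeast0LessThan algebra_simps intro!: prod.cong)
    also have "\<dots> = (\<Sum>X\<in>Pow {..<n}. (\<Prod>i\<in>X. y * F (h i - 1 + int (p i) - int i)) *
        (\<Prod>i\<in>{..<n} - X. F (h i + int (p i) - int i)))"
      by (rule prod_add) simp
    also have "\<dots> = (\<Sum>X\<in>Pow {..<n}. y ^ card X * (\<Prod>i=0..<n. F (lower X h i + int (p i) - int i)))"
    proof (rule sum.cong[OF refl])
      fix X assume X: "X \<in> Pow {..<n}"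
      have "(\<Prod>i=0..<n. F (lower X h i + int (p i) - int i)) =
          (\<Prod>i\<in>{..<n} - X. F (lower X h i + int (p i) - int i)) *
          (\<Prod>i\<in>X. F (lower X h i + int (p i) - int i))"
        unfolding atLeast0LessThan using X by (intro prod.subset_diff) auto
      also have "\<dots> = (\<Prod>i\<in>{..<n} - X. F (h i + int (p i) - int i)) *
          (\<Prod>i\<in>X. F (h i - 1 + int (p i) - int i))"
        by (intro arg_cong2[where f = "(*)"] prod.cong) (auto simp: lower_def)
      finally show "(\<Prod>i\<in>X. y * F (h i - 1 + int (p i) - int i)) *
        (\<Prod>i\<in>{..<n} - X. F (h i + int (p i) - int i)) =
        y ^ card X * (\<Prod>i=0..<n. F (lower X h i + int (p i) - int i))"
        by (simp add: prod.distrib mult_ac)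
    qed
    finally show "signof p * (\<Prod>i=0..<n. E (h i + int (p i) - int i)) =
      (\<Sum>X\<in>Pow {..<n}. y ^ card X * (signof p * (\<Prod>i=0..<n. F (lower X h i + int (p i) - int i))))"
      by (simp add: sum_distrib_left mult_ac)
  qed
  also have "\<dots> = (\<Sum>X\<in>Pow {..<n}. \<Sum>p\<in>?P. y ^ card X *
      (signof p * (\<Prod>i=0..<n. F (lower X h i + int (p i) - int i))))"
    by (rule sum.swap)
  also have "\<dots> = (\<Sum>X\<in>Pow {..<n}. y ^ card X * jt_det n (lower X h) F)"
    unfolding jt_det_def
    by (subst det_def') (auto intro!: sum.cong prod.cong simp: permutes_lt sum_distrib_left)
  finally show ?thesis .
qed

lemma jt_det_zero_row:
  assumes "i < n" "\<And>j. j < n \<Longrightarrow> E (h i + int j - int i) = 0"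
  shows "jt_det n h E = 0"
  unfolding jt_det_def by (subst laplace_expansion_row[OF _ assms(1)]) (use assms in auto)

text \<open>Lowering by at most one breaks h_i \<ge> h_(i+1) only if the two are equal and just i is
  lowered; the indices h_i - i + j then agree in rows i and i + 1. If the order survives, some
  length is negative, hence so is the last.\<close>

lemma jt_det_lower_not_part:
  assumes h: "is_part n h" and not: "\<not> is_part n (lower X h)" and E: "\<And>k. k < 0 \<Longrightarrow> E k = 0"
  shows "jt_det n (lower X h) E = 0"
proof (cases "\<exists>i. Suc i < n \<and> lower X h i < lower X h (Suc i)")
  case True
  then obtain i where i: "Suc i < n" "lower X h i < lower X h (Suc i)" by blast
  moreover have "h (Suc i) \<le> h i" using h i by (simp add: is_part_def)
  ultimately have eq: "lower X h (Suc i) = lower X h i + 1"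
    by (auto simp: lower_def of_bool_def split: if_splits)
  show ?thesis
    unfolding jt_det_def
    by (rule det_identical_rows[of _ n i "Suc i"]) (use i eq in \<open>auto simp: algebra_simps\<close>)
next
  case False
  then obtain i where i: "i < n" "lower X h i < 0"
    using not by (force simp: is_part_def)
  have "lower X h (n - 1) \<le> lower X h i"
  proof (rule decreasing_below[of n])
    show "lower X h (Suc k) \<le> lower X h k" if "Suc k < n" for k
      using False that by (meson not_less)
  qed (use i in auto)
  \<comment> \<open>In the last row j - (n - 1) \<le> 0, so every index is negative.\<close>
  with i show ?thesis
    by (intro jt_det_zero_row[of "n - 1"] E) auto
qed

text \<open>Base case of zero variables, where e_k = 0 for all k > 0. The matrix is the identity for
  the empty shape; otherwise h_0 > 0 and the top row has only positive indices.\<close>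

lemma jt_det_delta:
  assumes h: "is_part n h"
  shows "jt_det n h (\<lambda>k. of_bool (k = 0)) = of_bool (\<forall>i<n. h i = 0)"
proof (cases "\<forall>i<n. h i = 0")
  case True
  have "jt_det n h (\<lambda>k. of_bool (k = 0)) = det (1\<^sub>m n)"
    unfolding jt_det_def by (rule arg_cong[where f = det]) (use True in auto)
  with True show ?thesis by simp
next
  case False
  then obtain i where i: "i < n" "h i \<noteq> 0" by blast
  then have "0 < h i" using is_part_nonneg[OF h] by force
  then have "0 < h 0" using is_part_antimono[OF h, of 0 i] i by simp
  with i have "jt_det n h (\<lambda>k. of_bool (k = 0)) = (0::'a)"
    by (intro jt_det_zero_row[of 0]) auto
  with False show ?thesis by simp
qed

text \<open>The indeterminate \<open>X\<^sub>i\<close> stands for \<open>e\<^sub>i\<^sub>+\<^sub>1\<close>, hence the shift.\<close>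

definition e_seq :: "(nat \<Rightarrow> 'a::comm_ring_1) \<Rightarrow> int \<Rightarrow> 'a" where
  "e_seq a k = (if k < 0 then 0 else if k = 0 then 1 else a (nat k - 1))"

section \<open>Nonvanishing at a 0-1 point\<close>

lemma jt_det_last_zero:
  assumes "h n = 0" "\<And>k. k < 0 \<Longrightarrow> E k = 0" "E 0 = 1"
  shows "jt_det (Suc n) h E = jt_det n h E"
proof -
  let ?A = "mat (Suc n) (Suc n) (\<lambda>(i, j). E (h i + int j - int i))"
  have "det ?A = (\<Sum>j<Suc n. ?A $$ (n, j) * cofactor ?A n j)"
    by (rule laplace_expansion_row) auto
  \<comment> \<open>Since h_n = 0, the last row has indices j - n and reads 0, ..., 0, 1.\<close>
  also have "\<dots> = (\<Sum>j<n. ?A $$ (n, j) * cofactor ?A n j) + cofactor ?A n n"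
    using assms by simp
  also have "(\<Sum>j<n. ?A $$ (n, j) * cofactor ?A n j) = 0"
    using assms by (intro sum.neutral) auto
  also have "cofactor ?A n n = det (mat n n (\<lambda>(i, j). E (h i + int j - int i)))"
    unfolding cofactor_def mat_delete_def by (auto intro!: arg_cong[where f = det] simp flip: mult_2)
  finally show ?thesis by (simp add: jt_det_def)
qed

text \<open>Deleting the top row and the last column leaves indices h_(i+1) - 1 + j - i, again of
  Jacobi-Trudi form. The other cofactors stay implicit: it only matters that they are constant in
  the corner variable.\<close>

lemma jt_det_first_row:
  "jt_det (Suc n) h E = (\<Sum>j<n. E (h 0 + int j) *
       cofactor (mat (Suc n) (Suc n) (\<lambda>(i, j). E (h i + int j - int i))) 0 j)
     + E (h 0 + int n) * (- 1) ^ n * jt_det n (\<lambda>i. h (Suc i) - 1) E"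
proof -
  let ?A = "mat (Suc n) (Suc n) (\<lambda>(i, j). E (h i + int j - int i))"
  have "jt_det (Suc n) h E = (\<Sum>j<Suc n. ?A $$ (0, j) * cofactor ?A 0 j)"
    unfolding jt_det_def by (rule laplace_expansion_row) auto
  moreover have "mat_delete ?A 0 n = mat n n (\<lambda>(i, j). E (h (Suc i) - 1 + int j - int i))"
    unfolding mat_delete_def by (auto simp: algebra_simps)
  ultimately show ?thesis
    by (simp add: cofactor_def[of _ 0 n] jt_det_def)
qed

lemma jt_det_nonzero_01:
  assumes "is_part n h"
  shows "\<exists>a :: nat \<Rightarrow> 'f::field. (\<forall>i. a i \<in> {0, 1}) \<and> jt_det n h (e_seq a) \<noteq> 0"
  using assms
proof (induction n arbitrary: h)
  case 0
  show ?case by (intro exI[of _ "\<lambda>_. 0"]) (simp add: jt_det_def)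
next
  case (Suc n)
  show ?case
  proof (cases "h n = 0")
    case True
    have "is_part n h" using Suc.prems by (simp add: is_part_def)
    with Suc.IH show ?thesis by (simp add: jt_det_last_zero True e_seq_def)
  next
    case False
    have ge1: "1 \<le> h i" if "i < Suc n" for i
      using is_part_antimono[OF Suc.prems, of i n] is_part_nonneg[OF Suc.prems, of n] False that by simp
    \<comment> \<open>All columns are nonempty here, so dropping the first column and the first row
      leaves a partition.\<close>
    define g where "g = (\<lambda>i. h (Suc i) - 1)"
    have "is_part n g"
      unfolding g_def is_part_def
    proof (intro conjI allI impI)
      fix i assume "i < n"
      then show "0 \<le> h (Suc i) - 1" using ge1[of "Suc i"] by simp
    qed (use Suc.prems in \<open>auto simp: is_part_def\<close>)
    from Suc.IH[OF this] obtain a :: "nat \<Rightarrow> 'f"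
      where a: "\<And>i. a i \<in> {0, 1}" "jt_det n g (e_seq a) \<noteq> 0" by blast
    \<comment> \<open>The corner holds e_k with k = h_0 + n, which is the indeterminate
      X_(k-1).\<close>
    define m where "m = nat (h 0 + int n) - 1"
    have top: "e_seq (a(m := v)) (h 0 + int n) = v" for v
      using ge1[of 0] by (simp add: e_seq_def m_def)
    have other: "e_seq (a(m := v)) k = e_seq a k" if "k < h 0 + int n" for v k
      using that by (auto simp: e_seq_def m_def)
    \<comment> \<open>Below the top row the index is at most h_0 + n - 1.\<close>
    have low: "e_seq (a(m := v)) (h (Suc i) + int j - int (Suc i)) = e_seq a (h (Suc i) + int j - int (Suc i))"
      if "i < n" "j \<le> n" for i j v
      using is_part_antimono[OF Suc.prems, of 0 "Suc i"] that by (intro other) auto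
    have minor: "jt_det n (\<lambda>i. h (Suc i) - 1) (e_seq (a(m := v))) = jt_det n g (e_seq a)" for v
      unfolding g_def by (rule jt_det_cong) (use low in \<open>force simp: algebra_simps\<close>)
    define A where "A v = mat (Suc n) (Suc n) (\<lambda>(i, j). e_seq (a(m := v)) (h i + int j - int i))" for v
    have cof: "cofactor (A v) 0 j = cofactor (A 0) 0 j" if "j < n" for v j
    proof -
      have "mat_delete (A v) 0 j =
          mat n n (\<lambda>(i, k). e_seq a (h (Suc i) + int (if k < j then k else Suc k) - int (Suc i)))" for v
        unfolding A_def mat_delete_def
        by (rule eq_matI) (use low that in \<open>auto simp del: of_nat_Suc\<close>)
      then show ?thesis by (simp add: cofactor_def)
    qed
    define C where "C = (\<Sum>j<n. e_seq a (h 0 + int j) * cofactor (A 0) 0 j)"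
    have val: "jt_det (Suc n) h (e_seq (a(m := v))) = C + v * ((- 1) ^ n * jt_det n g (e_seq a))" for v
      unfolding jt_det_first_row A_def[symmetric] minor top C_def
      by (intro arg_cong2[where f = "(+)"] sum.cong refl) (simp_all add: cof[of _ v] other)
    have nz: "(- 1) ^ n * jt_det n g (e_seq a) \<noteq> 0" using a by simp
    obtain v :: 'f where v: "v \<in> {0, 1}" "C + v * ((- 1) ^ n * jt_det n g (e_seq a)) \<noteq> 0"
    proof (cases "C = 0")
      case True
      then show ?thesis using that[of 1] nz by simp
    next
      case False
      then show ?thesis using that[of 0] by simp
    qed
    have "(a(m := v)) i \<in> {0, 1}" for i using a(1) v(1) by simp
    then show ?thesis
      using v(2) unfolding val[symmetric] by blast
  qed
qed

section \<open>Tableaux\<close>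

lemma esym_0 [simp]: "esym x 0 N = 1"
proof -
  have "{S. S \<subseteq> {..<N} \<and> card S = 0} = {{}}" by (auto simp: card_eq_0_iff finite_subset)
  then show ?thesis by (simp add: esym_def)
qed

lemma esym_Suc_0 [simp]: "esym x (Suc k) 0 = 0"
  unfolding esym_def by (rule sum.neutral) auto

lemma esym_Suc_Suc: "esym x (Suc k) (Suc N) = esym x (Suc k) N + x N * esym x k N"
proof -
  let ?A = "{S. S \<subseteq> {..<N} \<and> card S = Suc k}" and ?B = "{S. S \<subseteq> {..<N} \<and> card S = k}"
  have fin: "finite S" if "S \<subseteq> {..<N}" for S using that finite_subset by auto
  have N: "N \<notin> S" if "S \<subseteq> {..<N}" for S using that by auto
  have "{S. S \<subseteq> {..<Suc N} \<and> card S = Suc k} = ?A \<union> insert N ` ?B"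
  proof (intro equalityI subsetI)
    fix S assume S: "S \<in> {S. S \<subseteq> {..<Suc N} \<and> card S = Suc k}"
    show "S \<in> ?A \<union> insert N ` ?B"
    proof (cases "N \<in> S")
      case True
      then have "S = insert N (S - {N})" "S - {N} \<in> ?B"
        using S finite_subset[of S "{..<Suc N}"] by (auto simp: less_Suc_eq)
      then show ?thesis by blast
    next
      case False
      then show ?thesis using S by (auto simp: less_Suc_eq)
    qed
  next
    fix S assume "S \<in> ?A \<union> insert N ` ?B"
    then show "S \<in> {S. S \<subseteq> {..<Suc N} \<and> card S = Suc k}"
      using fin N by (auto simp: card_insert_if less_Suc_eq)
  qed
  then have "esym x (Suc k) (Suc N) = (\<Sum>S\<in>?A \<union> insert N ` ?B. \<Prod>i\<in>S. x i)"
    by (simp add: esym_def)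
  also have "\<dots> = (\<Sum>S\<in>?A. \<Prod>i\<in>S. x i) + (\<Sum>S\<in>insert N ` ?B. \<Prod>i\<in>S. x i)"
    by (rule sum.union_disjoint) auto
  also have "(\<Sum>S\<in>insert N ` ?B. \<Prod>i\<in>S. x i) = (\<Sum>S\<in>?B. \<Prod>i\<in>insert N S. x i)"
    by (subst sum.reindex) (use N in \<open>auto simp: inj_on_def insert_ident\<close>)
  also have "\<dots> = (\<Sum>S\<in>?B. x N * (\<Prod>i\<in>S. x i))"
    using fin N by (intro sum.cong) auto
  finally show ?thesis by (simp add: esym_def sum_distrib_left)
qed

text \<open>The conventions e_0 = 1 and e_k = 0 for k < 0 extend the recursion to all integers k, as
  the row expansion requires.\<close>

lemma e_seq_esym_Suc:
  "e_seq (\<lambda>i. esym x (Suc i) (Suc N)) k =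
     e_seq (\<lambda>i. esym x (Suc i) N) k + x N * e_seq (\<lambda>i. esym x (Suc i) N) (k - 1)"
proof (cases "k \<le> 0")
  case False
  then obtain j where "k = int (Suc j)"
    by (metis Suc_pred' int_nat_eq linorder_not_le zero_less_nat_eq order.strict_implies_order)
  then show ?thesis by (cases j) (auto simp: e_seq_def esym_Suc_Suc nat_add_distrib)
qed (auto simp: e_seq_def)

section \<open>Tableaux and the removal of their largest entry\<close>

definition col_diagram :: "nat \<Rightarrow> (nat \<Rightarrow> int) \<Rightarrow> (nat \<times> nat) set" where
  "col_diagram n h = {(r, c). c < n \<and> int r < h c}"

text \<open>Defined on any set of cells, so that a diagram given by row lengths can be exchanged for
  the same set given by column lengths.\<close>

definition tableaux :: "(nat \<times> nat) set \<Rightarrow> nat \<Rightarrow> (nat \<times> nat \<Rightarrow> nat) set" where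
  "tableaux D N =
    {T \<in> D \<rightarrow>\<^sub>E {..<N}.
       (\<forall>r c c'. c < c' \<and> (r, c') \<in> D \<longrightarrow> T (r, c) \<le> T (r, c')) \<and>
       (\<forall>r r' c. r < r' \<and> (r', c) \<in> D \<longrightarrow> T (r, c) < T (r', c))}"

definition tab_sum :: "(nat \<Rightarrow> 'a::comm_ring_1) \<Rightarrow> (nat \<times> nat) set \<Rightarrow> nat \<Rightarrow> 'a" where
  "tab_sum x D N = (\<Sum>T\<in>tableaux D N. \<Prod>b\<in>D. x (T b))"

lemma schur_eq_tab_sum: "schur lam N = tab_sum mvar (young_diagram lam) N"
  by (simp add: schur_def tab_sum_def ssyt_def tableaux_def)

lemma finite_diag: "finite (col_diagram n h)"
proof (rule finite_subset)
  show "col_diagram n h \<subseteq> (\<Union>c<n. (\<lambda>r. (r, c)) ` {..<nat (h c)})"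
    by (auto simp: col_diagram_def)
qed simp

lemma finite_tableaux: "finite D \<Longrightarrow> finite (tableaux D N)"
  unfolding tableaux_def by (rule finite_subset[OF _ finite_PiE[of D "\<lambda>_. {..<N}"]]) auto

text \<open>Bottom cell of column c. For an empty column the truncated subtraction gives row 0,
  which is not a cell; hence the positivity conditions below.\<close>

definition foot :: "(nat \<Rightarrow> int) \<Rightarrow> nat \<Rightarrow> nat \<times> nat" where
  "foot h c = (nat (h c) - 1, c)"

text \<open>Nonnegativity of the lowered lengths makes the columns in X nonempty, so their feet are
  cells.\<close>

lemma diag_lower:
  assumes "is_part n (lower X h)" "X \<subseteq> {..<n}"
  shows "col_diagram n h = col_diagram n (lower X h) \<union> foot h ` X" "col_diagram n (lower X h) \<inter> foot h ` X = {}"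
proof -
  have pos: "0 < h c" if "c \<in> X" for c
    using is_part_nonneg[OF assms(1), of c] that assms(2) by (auto simp: lower_def)
  show "col_diagram n h = col_diagram n (lower X h) \<union> foot h ` X"
  proof (intro equalityI subsetI)
    fix b assume "b \<in> col_diagram n h"
    then obtain r c where b: "b = (r, c)" "c < n" "int r < h c" by (auto simp: col_diagram_def)
    show "b \<in> col_diagram n (lower X h) \<union> foot h ` X"
    proof (cases "c \<in> X \<and> r = nat (h c) - 1")
      case True
      then show ?thesis by (auto simp: b foot_def)
    next
      case False
      then have "b \<in> col_diagram n (lower X h)" using b by (auto simp: col_diagram_def lower_def)
      then show ?thesis ..
    qed
  next
    fix b assume "b \<in> col_diagram n (lower X h) \<union> foot h ` X"
    then show "b \<in> col_diagram n h" using pos assms(2)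
      by (force simp: col_diagram_def lower_def foot_def of_bool_def split: if_splits)
  qed
  show "col_diagram n (lower X h) \<inter> foot h ` X = {}"
    using pos by (force simp: col_diagram_def lower_def foot_def)
qed

lemma diag_left: "is_part n h \<Longrightarrow> (r, c') \<in> col_diagram n h \<Longrightarrow> c < c' \<Longrightarrow> (r, c) \<in> col_diagram n h"
  using is_part_antimono[of n h c c'] by (auto simp: col_diagram_def)

lemma diag_up: "(r', c) \<in> col_diagram n h \<Longrightarrow> r < r' \<Longrightarrow> (r, c) \<in> col_diagram n h"
  by (auto simp: col_diagram_def)

text \<open>In a tableau with entries at most N, strict columns allow N only at a foot, so these are
  exactly the columns containing N.\<close>

definition max_cols :: "nat \<Rightarrow> (nat \<Rightarrow> int) \<Rightarrow> nat \<Rightarrow> (nat \<times> nat \<Rightarrow> nat) \<Rightarrow> nat set" where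
  "max_cols n h N T = {c. c < n \<and> 0 < h c \<and> T (foot h c) = N}"

lemma tableauxD:
  assumes "T \<in> tableaux D N"
  shows "b \<in> D \<Longrightarrow> T b < N" "b \<notin> D \<Longrightarrow> T b = undefined"
    "c < c' \<Longrightarrow> (r, c') \<in> D \<Longrightarrow> T (r, c) \<le> T (r, c')"
    "r < r' \<Longrightarrow> (r', c) \<in> D \<Longrightarrow> T (r, c) < T (r', c)"
  using assms unfolding tableaux_def PiE_iff extensional_def by blast+

lemma foot_in_diag: "c < n \<Longrightarrow> 0 < h c \<Longrightarrow> foot h c \<in> col_diagram n h"
  by (auto simp: foot_def col_diagram_def)

text \<open>If columns i and i + 1 are equally long, their feet lie in one row, so an N at the first
  forces an N at the second.\<close>

lemma is_part_lower_max_cols: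
  assumes h: "is_part n h" and T: "T \<in> tableaux (col_diagram n h) (Suc N)"
  shows "is_part n (lower (max_cols n h N T) h)"
  unfolding is_part_def
proof (intro conjI allI impI)
  let ?X = "max_cols n h N T"
  fix i assume i: "Suc i < n"
  have le: "h (Suc i) \<le> h i" using h i by (simp add: is_part_def)
  show "lower ?X h (Suc i) \<le> lower ?X h i"
  proof (cases "h (Suc i) = h i \<and> i \<in> ?X")
    case True
    then have *: "foot h (Suc i) \<in> col_diagram n h" "T (foot h i) = N" "0 < h (Suc i)"
      using i by (auto simp: max_cols_def intro: foot_in_diag)
    have "T (foot h i) \<le> T (foot h (Suc i))"
      using tableauxD(3)[OF T, of i "Suc i" "nat (h i) - 1"] *(1) True by (simp add: foot_def)
    moreover have "T (foot h (Suc i)) < Suc N" using tableauxD(1)[OF T] * by blast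
    ultimately have "Suc i \<in> ?X" using * i by (simp add: max_cols_def)
    then show ?thesis using le True by (simp add: lower_def)
  qed (use le in \<open>auto simp: lower_def of_bool_def\<close>)
next
  fix i assume "i < n"
  then show "0 \<le> lower (max_cols n h N T) h i"
    using is_part_nonneg[OF h, of i] by (auto simp: lower_def max_cols_def)
qed

text \<open>A remaining cell either lies above the foot of its column, hence has a smaller entry, or
  is a foot that does not carry N.\<close>

lemma restrict_tableau:
  assumes h: "is_part n h" and T: "T \<in> tableaux (col_diagram n h) (Suc N)" and X: "max_cols n h N T = X"
  shows "restrict T (col_diagram n (lower X h)) \<in> tableaux (col_diagram n (lower X h)) N"
proof -
  let ?D = "col_diagram n (lower X h)"
  have pX: "is_part n (lower X h)" using is_part_lower_max_cols[OF h T] X by simp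
  have XN: "X \<subseteq> {..<n}" using X by (auto simp: max_cols_def)
  have sub: "?D \<subseteq> col_diagram n h" using diag_lower(1)[OF pX XN] by blast
  have lt: "T b < N" if "b \<in> ?D" for b
  proof -
    obtain r c where b: "b = (r, c)" "c < n" "int r < lower X h c" using \<open>b \<in> ?D\<close> by (auto simp: col_diagram_def)
    have hc: "int r < h c" using b by (auto simp: lower_def of_bool_def split: if_splits)
    have fd: "foot h c \<in> col_diagram n h" using b hc by (intro foot_in_diag) auto
    show ?thesis
    proof (cases "r = nat (h c) - 1")
      case True
      then have "c \<notin> X" using b hc by (auto simp: lower_def)
      then have "T b \<noteq> N" using X b hc True by (auto simp: max_cols_def foot_def)
      then show ?thesis using tableauxD(1)[OF T, of b] sub \<open>b \<in> ?D\<close> by force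
    next
      case False
      then have "T b < T (foot h c)"
        using tableauxD(4)[OF T, of r "nat (h c) - 1" c] fd b hc by (simp add: foot_def)
      then show ?thesis using tableauxD(1)[OF T fd] by simp
    qed
  qed
  have "restrict T ?D \<in> ?D \<rightarrow>\<^sub>E {..<N}" using lt by auto
  moreover have "restrict T ?D (r, c) \<le> restrict T ?D (r, c')" if "c < c'" "(r, c') \<in> ?D" for r c c'
    using tableauxD(3)[OF T] that sub diag_left[OF pX that(2,1)] by auto
  moreover have "restrict T ?D (r, c) < restrict T ?D (r', c)" if "r < r'" "(r', c) \<in> ?D" for r c r'
    using tableauxD(4)[OF T] that sub diag_up[OF that(2,1)] by auto
  ultimately show ?thesis
    unfolding tableaux_def by blast
qed

definition add_feet :: "(nat \<Rightarrow> int) \<Rightarrow> nat \<Rightarrow> nat set \<Rightarrow> (nat \<times> nat \<Rightarrow> nat) \<Rightarrow> nat \<times> nat \<Rightarrow> nat" where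
  "add_feet h N X T = (\<lambda>b. if b \<in> foot h ` X then N else T b)"

text \<open>As the lowered shape is a partition, no old cell lies to the right of or below a new
  one, so the largest entry may be placed there. Old entries are below N, so X can be read off
  again.\<close>

lemma add_feet_tableau:
  assumes h: "is_part n h" and pX: "is_part n (lower X h)" and XN: "X \<subseteq> {..<n}"
    and T: "T \<in> tableaux (col_diagram n (lower X h)) N"
  shows "add_feet h N X T \<in> tableaux (col_diagram n h) (Suc N)" "max_cols n h N (add_feet h N X T) = X"
proof -
  let ?D = "col_diagram n (lower X h)" and ?T = "add_feet h N X T"
  note dl = diag_lower[OF pX XN]
  have TD: "?T b = T b" if "b \<in> ?D" for b
    using that dl(2) unfolding add_feet_def by (metis disjoint_iff)
  have TF: "?T b = N" if "b \<in> foot h ` X" for b using that by (simp add: add_feet_def)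
  have lt: "?T b < N" if "b \<in> ?D" for b using TD that tableauxD(1)[OF T] by simp
  have le: "?T b \<le> N" if "b \<in> col_diagram n h" for b
  proof -
    have "b \<in> ?D \<or> b \<in> foot h ` X" using that dl(1) by blast
    then show ?thesis using lt[of b] TF[of b] by linarith
  qed
  have "?T (r, c) \<le> ?T (r, c')" if "c < c'" "(r, c') \<in> col_diagram n h" for r c c'
  proof (cases "(r, c') \<in> ?D")
    case True
    then show ?thesis using TD diag_left[OF pX True] that tableauxD(3)[OF T] by simp
  next
    case False
    then have "?T (r, c') = N" using that dl TF by blast
    then show ?thesis using le diag_left[OF h that(2,1)] by simp
  qed
  moreover have "?T (r, c) < ?T (r', c)" if "r < r'" "(r', c) \<in> col_diagram n h" for r c r'
  proof -
    \<comment> \<open>Only the last cell of a column can be new, so a cell with another one below it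
      is old.\<close>
    have D: "(r, c) \<in> ?D" using that by (auto simp: col_diagram_def lower_def)
    show ?thesis
    proof (cases "(r', c) \<in> ?D")
      case True
      then show ?thesis using TD D that tableauxD(4)[OF T] by simp
    next
      case False
      then have "?T (r', c) = N" using that dl TF by blast
      then show ?thesis using lt[OF D] by simp
    qed
  qed
  moreover have "?T b = undefined" if "b \<notin> col_diagram n h" for b
    using that dl(1) tableauxD(2)[OF T, of b] unfolding add_feet_def by (metis Un_iff)
  ultimately show "?T \<in> tableaux (col_diagram n h) (Suc N)"
    unfolding tableaux_def using le by (auto simp: PiE_iff extensional_def less_Suc_eq_le)
  have "c \<in> max_cols n h N ?T \<longleftrightarrow> c \<in> X" for c
  proof (cases "c \<in> X")
    case True
    then have "0 < h c" "c < n" using is_part_nonneg[OF pX, of c] XN by (auto simp: lower_def)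
    then show ?thesis using True TF[of "foot h c"] by (simp add: max_cols_def)
  next
    case False
    have "?T (foot h c) < N" if "c < n" "0 < h c"
      using that False by (intro lt) (auto simp: col_diagram_def foot_def lower_def)
    then show ?thesis using False by (auto simp: max_cols_def)
  qed
  then show "max_cols n h N ?T = X" by blast
qed

text \<open>Deleting and refilling the feet are inverse bijections, and each deleted entry
  contributes a factor x_N.\<close>

lemma tab_sum_max_cols:
  assumes h: "is_part n h" and pX: "is_part n (lower X h)" and XN: "X \<subseteq> {..<n}"
  shows "(\<Sum>T\<in>{T \<in> tableaux (col_diagram n h) (Suc N). max_cols n h N T = X}. \<Prod>b\<in>col_diagram n h. x (T b)) =
    x N ^ card X * tab_sum x (col_diagram n (lower X h)) N"
  unfolding tab_sum_def sum_distrib_left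
proof (rule sum.reindex_bij_witness[where i = "add_feet h N X" and j = "\<lambda>T. restrict T (col_diagram n (lower X h))"])
  let ?D = "col_diagram n (lower X h)"
  note dl = diag_lower[OF pX XN]
  {
    fix T assume "T \<in> {T \<in> tableaux (col_diagram n h) (Suc N). max_cols n h N T = X}"
    then have T: "T \<in> tableaux (col_diagram n h) (Suc N)" and X: "max_cols n h N T = X" by auto
    have foot: "T b = N" if "b \<in> foot h ` X" for b using that X by (auto simp: max_cols_def)
    show "add_feet h N X (restrict T ?D) = T"
    proof
      fix b
      consider "b \<in> ?D" | "b \<in> foot h ` X" | "b \<notin> col_diagram n h" using dl by blast
      then show "add_feet h N X (restrict T ?D) b = T b"
        using dl foot tableauxD(2)[OF T] by cases (auto simp: add_feet_def)
    qed
    show "restrict T ?D \<in> tableaux ?D N" by (rule restrict_tableau[OF h T X])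
    have "inj_on (foot h) X" by (auto simp: inj_on_def foot_def)
    then have "(\<Prod>b\<in>foot h ` X. x (T b)) = x N ^ card X"
      using foot by (simp add: card_image)
    moreover have "(\<Prod>b\<in>col_diagram n h. x (T b)) = (\<Prod>b\<in>?D. x (T b)) * (\<Prod>b\<in>foot h ` X. x (T b))"
      unfolding dl(1) using dl(2) finite_subset[OF XN]
      by (intro prod.union_disjoint) (auto simp: finite_diag)
    ultimately show "x N ^ card X * (\<Prod>b\<in>?D. x (restrict T ?D b)) = (\<Prod>b\<in>col_diagram n h. x (T b))"
      by (simp add: mult.commute)
  next
    fix T assume T: "T \<in> tableaux ?D N"
    show "restrict (add_feet h N X T) ?D = T"
    proof
      fix b show "restrict (add_feet h N X T) ?D b = T b"
        using tableauxD(2)[OF T] dl(2) by (auto simp: add_feet_def)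
    qed
    show "add_feet h N X T \<in> {T \<in> tableaux (col_diagram n h) (Suc N). max_cols n h N T = X}"
      using add_feet_tableau[OF h pX XN T] by simp
  }
qed

text \<open>The branching rule for Schur polynomials: tableaux are grouped by the columns that
  contain N.\<close>

lemma tab_sum_Suc:
  assumes "is_part n h"
  shows "tab_sum x (col_diagram n h) (Suc N) =
    (\<Sum>X\<in>{X \<in> Pow {..<n}. is_part n (lower X h)}. x N ^ card X * tab_sum x (col_diagram n (lower X h)) N)"
proof -
  let ?G = "{X \<in> Pow {..<n}. is_part n (lower X h)}"
  have "tab_sum x (col_diagram n h) (Suc N) =
      (\<Sum>X\<in>?G. \<Sum>T\<in>{T \<in> tableaux (col_diagram n h) (Suc N). max_cols n h N T = X}. \<Prod>b\<in>col_diagram n h. x (T b))"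
    unfolding tab_sum_def
    by (rule sum.group[symmetric])
       (auto simp: finite_tableaux finite_diag is_part_lower_max_cols[OF assms], auto simp: max_cols_def)
  also have "\<dots> = (\<Sum>X\<in>?G. x N ^ card X * tab_sum x (col_diagram n (lower X h)) N)"
    using assms by (intro sum.cong refl tab_sum_max_cols) auto
  finally show ?thesis .
qed

lemma tab_sum_0:
  assumes "is_part n h"
  shows "tab_sum x (col_diagram n h) 0 = of_bool (\<forall>i<n. h i = 0)"
proof (cases "\<forall>i<n. h i = 0")
  case True
  then have "col_diagram n h = {}" by (auto simp: col_diagram_def)
  moreover have "tableaux {} 0 = {\<lambda>_. undefined}" by (auto simp: tableaux_def)
  ultimately show ?thesis using True by (simp add: tab_sum_def)
next
  case False
  then obtain i where "i < n" "h i \<noteq> 0" by blast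
  then have "(0, i) \<in> col_diagram n h" using is_part_nonneg[OF assms, of i] by (auto simp: col_diagram_def)
  then have "tableaux (col_diagram n h) 0 = {}" using tableauxD(1) by blast
  then show ?thesis using False by (simp add: tab_sum_def)
qed

text \<open>Induction on the number of variables. Removing the largest entry from all columns of a tableau
  gives a recursion for the tableau sum. Expanding every row of the determinant by
  \<open>e\<^sub>k(x\<^sub>0,\<dots>,x\<^sub>N) = e\<^sub>k(x\<^sub>0,\<dots>,x\<^sub>N\<^sub>-\<^sub>1) + x\<^sub>N e\<^sub>k\<^sub>-\<^sub>1(x\<^sub>0,\<dots>,x\<^sub>N\<^sub>-\<^sub>1)\<close> gives the same recursion, because the
  terms that do not belong to a partition have two equal rows or a zero row.\<close>

theorem dual_Jacobi_Trudi:
  assumes "is_part n h"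
  shows "tab_sum x (col_diagram n h) N = jt_det n h (e_seq (\<lambda>i. esym x (Suc i) N))"
  using assms
proof (induction N arbitrary: h)
  case 0
  have "e_seq (\<lambda>i. esym x (Suc i) 0) = (\<lambda>k. of_bool (k = 0))"
    by (auto simp: e_seq_def fun_eq_iff)
  then show ?case using 0 by (simp add: tab_sum_0 jt_det_delta)
next
  case (Suc N)
  let ?F = "e_seq (\<lambda>i. esym x (Suc i) N)"
  have "jt_det n h (e_seq (\<lambda>i. esym x (Suc i) (Suc N))) =
      (\<Sum>X\<in>Pow {..<n}. x N ^ card X * jt_det n (lower X h) ?F)"
    by (intro jt_det_row_expansion e_seq_esym_Suc)
  also have "\<dots> = (\<Sum>X\<in>{X \<in> Pow {..<n}. is_part n (lower X h)}. x N ^ card X * jt_det n (lower X h) ?F)"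
    by (rule sum.mono_neutral_right)
       (auto simp: e_seq_def jt_det_lower_not_part[OF Suc.prems])
  also have "\<dots> = (\<Sum>X\<in>{X \<in> Pow {..<n}. is_part n (lower X h)}. x N ^ card X * tab_sum x (col_diagram n (lower X h)) N)"
    by (simp add: Suc.IH)
  finally show ?case by (simp add: tab_sum_Suc[OF Suc.prems])
qed

section \<open>Column lengths of a partition, and the conclusion\<close>

lemma downward_closed_eq_lessThan:
  fixes A :: "nat set"
  assumes "finite A" and down: "\<And>i j. j \<in> A \<Longrightarrow> i < j \<Longrightarrow> i \<in> A"
  shows "A = {..<card A}"
proof (intro equalityI subsetI)
  fix r assume "r \<in> A"
  then have "{..r} \<subseteq> A" using down by (auto simp: le_less)
  from card_mono[OF assms(1) this] show "r \<in> {..<card A}" by simp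
next
  fix r assume r: "r \<in> {..<card A}"
  show "r \<in> A"
  proof (rule ccontr)
    assume "r \<notin> A"
    then have "A \<subseteq> {..<r}" using down by (metis lessThan_iff linorder_neqE_nat subsetI)
    from card_mono[OF _ this] r show False by simp
  qed
qed

lemma young_diagram_eq_diag:
  assumes "is_partition lam"
  obtains n h where "is_part n h" "young_diagram lam = col_diagram n h"
proof -
  define A where "A c = {r. r < length lam \<and> c < lam ! r}" for c
  define h where "h c = int (card (A c))" for c
  \<comment> \<open>A crude bound on the number of columns; surplus columns have length
    zero.\<close>
  define n where "n = sum_list lam"
  have fin: "finite (A c)" for c by (simp add: A_def)
  have dec: "lam ! j \<le> lam ! i" if "i < j" "j < length lam" for i j
    using assms that unfolding is_partition_def by (simp add: sorted_wrt_iff_nth_less)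
  have A: "A c = {..<card (A c)}" for c
    using dec by (intro downward_closed_eq_lessThan fin) (force simp: A_def)
  have "A (Suc c) \<subseteq> A c" for c by (auto simp: A_def)
  then have "is_part n h" by (simp add: is_part_def h_def card_mono[OF fin])
  moreover have "young_diagram lam = col_diagram n h"
  proof -
    have "(r, c) \<in> young_diagram lam \<longleftrightarrow> (r, c) \<in> col_diagram n h" for r c
    proof -
      have "(r, c) \<in> young_diagram lam \<longleftrightarrow> r \<in> A c" by (simp add: young_diagram_def A_def)
      moreover have "r \<in> A c \<longleftrightarrow> int r < h c" using A[of c] by (auto simp: h_def)
      moreover have "c < n" if "r \<in> A c"
        using that elem_le_sum_list[of r lam] by (auto simp: A_def n_def)
      ultimately show ?thesis by (auto simp: col_diagram_def)
    qed
    then show ?thesis by auto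
  qed
  ultimately show ?thesis by (rule that)
qed

text \<open>Determinants commute with ring homomorphisms, so the determinant in the indeterminates
  specialises both to symmetric polynomials and to 0-1 values.\<close>

lemma int_eval_jt_det: "int_eval (jt_det n h (e_seq y)) a = jt_det n h (e_seq (\<lambda>i. int_eval (y i) a))"
proof -
  interpret comm_ring_hom "\<lambda>P. int_eval P a" by (rule comm_ring_hom_int_eval)
  show ?thesis
    unfolding jt_det_def hom_det[symmetric]
    by (rule arg_cong[where f = det]) (auto simp: e_seq_def)
qed

theorem theorem2:
  fixes lam :: "nat list"
  assumes "is_partition lam"
  shows "\<exists>a :: nat \<Rightarrow> 'f::field.
           (\<forall>i. a i \<in> {0, 1}) \<and> mpoly_eval (mpoly_of_int (schur_elem_poly lam)) a \<noteq> 0"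
proof -
  obtain n h where h: "is_part n h" and D: "young_diagram lam = col_diagram n h"
    by (rule young_diagram_eq_diag[OF assms])
  let ?P = "jt_det n h (e_seq mvar)"
  \<comment> \<open>The tableau identity holds in every commutative ring; here it is read at the
    variables themselves, \<open>x = mvar\<close>.\<close>
  have "schur lam = eval_at_elem_sym ?P"
    by (rule ext)
       (simp add: schur_eq_tab_sum D dual_Jacobi_Trudi[OF h] eval_at_elem_sym_def mpoly_eval_of_int
          int_eval_jt_det elem_sym_eq_esym)
  then have "schur_elem_poly lam = ?P"
    unfolding schur_elem_poly_def by (metis (mono_tags, lifting) eval_at_elem_sym_inj the_equality)
  then show ?thesis
    using jt_det_nonzero_01[OF h, where 'f = 'f]
    by (simp add: mpoly_eval_of_int int_eval_jt_det)
qed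

end
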